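(* Let $(\mathfrak g,\cdot)$ be a finite-dimensional real pre-Lie algebra with a non-degenerate, invariant, skew-symmetric bilinear form $\omega$. Let $d_1,d_2,d_3$ be symmetric endomorphisms of $(\mathfrak g,\omega)$ and set $\mathscr B_i(x,y)=\omega(d_i(x),y)$ for all $x,y\in\mathfrak g$, $i=1,2,3$. Then $(d_1,d_2,d_3)$ is an $\varepsilon$-hyper differential operator on the pre-Lie algebra $\mathfrak g$ if and only if $(\mathscr B_1,\mathscr B_2,\mathscr B_3)$ is an $\varepsilon$-hyper Hessian structure on $\mathfrak g$.
   Context: Here $\varepsilon=(\varepsilon_1,\varepsilon_2,\varepsilon_3)$ with $\varepsilon_i\in\{1,-1\}$, and indices are taken mod 3. A pre-Lie algebra is a vector space $\mathfrak g$ with a bilinear product $\cdot$ satisfying $(x\cdot y)\cdot z-x\cdot(y\cdot z)=(y\cdot x)\cdot z-y\cdot(x\cdot z)$. Its sub-adjacent Lie algebra $\mathfrak g^c$ is $\mathfrak g$ with bracket $[x,y]=x\cdot y-y\cdot x$. The coregular representation $(\mathfrak g^*;L^* )$ of $\mathfrak g^c$ is given by $\langle L^*_x\xi,y\rangle=-\langle\xi,x\cdot y\rangle$. A nondegenerate skew-symmetric bilinear form $\omega$ on $\mathfrak g$ is invariant if $\omega(x\cdot y,z)+\omega(y,[x,z])=0$ for all $x,y,z\in\mathfrak g$. A symmetric endomorphism of $(\mathfrak g,\omega)$ is a linear map $\varphi:\mathfrak g\to\mathfrak g$ with $\omega(\varphi(x),y)=\omega(\varphi(y),x)$ for all $x,y\in\mathfrak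 g$. A derivation of the pre-Lie algebra is a linear map $d:\mathfrak g\to\mathfrak g$ with $d(x\cdot y)=d(x)\cdot y+x\cdot d(y)$ for all $x,y$. An $\varepsilon$-hyper differential operator on the pre-Lie algebra $\mathfrak g$ is a triple $(d_1,d_2,d_3)$ of invertible derivations of the pre-Lie algebra such that $(d_{i-1}^{-1}\circ d_{i+1})^2=\varepsilon_i\,\mathrm{Id}_{\mathfrak g}$ for $i=1,2,3$. A Hessian structure on $(\mathfrak g,\cdot)$ is a nondegenerate symmetric bilinear form $\mathscr B:\mathfrak g\otimes\mathfrak g\to\mathbb R$ with $\mathscr B(x\cdot y,z)-\mathscr B(x,y\cdot z)=\mathscr B(y\cdot x,z)-\mathscr B(y,x\cdot z)$ for all $x,y,z$; define $\mathscr B^\natural:\mathfrak g\to\mathfrak g^*$ by $\langle\mathscr B^\natural(x),y\rangle=\mathscr B(x,y)$. For a Lie algebra $\mathfrak h$ with representation $(V;\rho)$, a relative differential operator is a linear map $d:\mathfrak h\to V$ with $d[x,y]=\rho(x)d(y)-\rho(y)d(x)$; invertible relative differential operators $D_1,D_2,D_3$ with respect to $(V;\rho)$ form an $\varepsilon$-hyper relative differential operator if $(D_{i-1}^{-1}\circ D_{i+1})^2=\varepsilon_i\,\mathrm{Id}$ for $i=1,2,3$. An $\varepsilon$-hyper Hessian structure on $\mathfrak g$ is a triple $(\mathscr B_1,\mathscr B_2,\mathscr B_3)$ of Hessian structures such that $(\mathscr B_1^\natural,\mathscr B_2^\natural,\mathscr B_3^\natural)$ is an $\varepsilon$-hyper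 relative differential operator on $\mathfrak g^c$ with respect to $(\mathfrak g^*;L^* )$. *)

theory Defs
  imports "HOL-Analysis.Linear_Algebra" "HOL-Library.Numeral_Type"
begin

text \<open>The (algebraic) dual space; \<open>ev \<xi> y\<close> is the pairing of \<open>\<xi>\<close> with \<open>y\<close>.\<close>

typedef (overloaded) 'a dual = "{f :: 'a::real_vector \<Rightarrow> real. linear f}"
  morphisms ev Dual
  by (auto intro: linear_zero)

setup_lifting type_definition_dual

instantiation dual :: (real_vector) real_vector
begin

lift_definition zero_dual :: "'a dual" is "\<lambda>_. 0"
  by (rule linear_zero)

lift_definition plus_dual :: "'a dual \<Rightarrow> 'a dual \<Rightarrow> 'a dual" is "\<lambda>f g x. f x + g x"
  by (rule linear_compose_add)

lift_definition uminus_dual :: "'a dual \<Rightarrow> 'a dual" is "\<lambda>f x. - f x"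
  by (rule linear_compose_neg)

lift_definition minus_dual :: "'a dual \<Rightarrow> 'a dual \<Rightarrow> 'a dual" is "\<lambda>f g x. f x - g x"
  by (rule linear_compose_sub)

lift_definition scaleR_dual :: "real \<Rightarrow> 'a dual \<Rightarrow> 'a dual" is "\<lambda>c f x. c *\<^sub>R f x"
  by (rule linear_compose_scale_right)

instance
  by standard (transfer; auto simp: algebra_simps fun_eq_iff)+

end

lemma linear_ev: "linear (ev \<xi>)"
  using ev by blast

lemma ev_Dual: "linear f \<Longrightarrow> ev (Dual f) = f"
  by (simp add: Dual_inverse)

lemma dual_eqI: "(\<And>y. ev \<xi> y = ev \<eta> y) \<Longrightarrow> \<xi> = \<eta>"
  by (simp add: ev_inject[symmetric] fun_eq_iff)

lemmas ev_simps =
  zero_dual.rep_eq plus_dual.rep_eq uminus_dual.rep_eq minus_dual.rep_eq scaleR_dual.rep_eq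


locale lie_algebra =
  fixes bracket :: "'a::real_vector \<Rightarrow> 'a \<Rightarrow> 'a"
  assumes bilinear_bracket: "bilinear bracket"
    and bracket_self: "bracket x x = 0"
    and jacobi: "bracket x (bracket y z) + bracket y (bracket z x) + bracket z (bracket x y) = 0"

locale lie_algebra_representation = lie_algebra bracket
  for bracket :: "'a::real_vector \<Rightarrow> 'a \<Rightarrow> 'a" +
  fixes \<rho> :: "'a \<Rightarrow> 'v::real_vector \<Rightarrow> 'v"
  assumes bilinear_rho: "bilinear \<rho>"
    and rho_bracket: "\<rho> (bracket x y) v = \<rho> x (\<rho> y v) - \<rho> y (\<rho> x v)"
begin

definition relative_differential_operator :: "('a \<Rightarrow> 'v) \<Rightarrow> bool" where
  "relative_differential_operator D \<longleftrightarrow>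
     linear D \<and> (\<forall>x y. D (bracket x y) = \<rho> x (D y) - \<rho> y (D x))"

text \<open>Triples indexed modulo 3 are functions on the type \<open>3\<close> of integers modulo 3,
  in which \<open>3 = 0\<close>.\<close>

definition hyper_relative_differential_operator :: "(3 \<Rightarrow> real) \<Rightarrow> (3 \<Rightarrow> 'a \<Rightarrow> 'v) \<Rightarrow> bool" where
  "hyper_relative_differential_operator \<epsilon> D \<longleftrightarrow>
     (\<forall>i. relative_differential_operator (D i) \<and> bij (D i)) \<and>
     (\<forall>i. (inv (D (i - 1)) \<circ> D (i + 1)) ^^ 2 = (\<lambda>x. \<epsilon> i *\<^sub>R x))"

end


definition nondegenerate :: "('a::real_vector \<Rightarrow> 'a \<Rightarrow> real) \<Rightarrow> bool" where
  "nondegenerate B \<longleftrightarrow>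
     (\<forall>x. (\<forall>y. B x y = 0) \<longrightarrow> x = 0) \<and> (\<forall>y. (\<forall>x. B x y = 0) \<longrightarrow> y = 0)"

text \<open>The map from the space to its dual induced by a bilinear form.
  It is meaningful only for \<open>B\<close> linear in its second argument.\<close>

definition natural :: "('a::real_vector \<Rightarrow> 'a \<Rightarrow> real) \<Rightarrow> 'a \<Rightarrow> 'a dual" where
  "natural B x = Dual (B x)"

definition symmetric_endomorphism ::
    "('a::real_vector \<Rightarrow> 'a \<Rightarrow> real) \<Rightarrow> ('a \<Rightarrow> 'a) \<Rightarrow> bool" where
  "symmetric_endomorphism \<omega> \<phi> \<longleftrightarrow> linear \<phi> \<and> (\<forall>x y. \<omega> (\<phi> x) y = \<omega> (\<phi> y) x)"


locale pre_lie_algebra =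
  fixes mul :: "'a::real_vector \<Rightarrow> 'a \<Rightarrow> 'a"  (infixl \<open>\<cdot>\<close> 70)
  assumes bilinear_mul: "bilinear (\<cdot>)"
    and pre_lie: "(x \<cdot> y) \<cdot> z - x \<cdot> (y \<cdot> z) = (y \<cdot> x) \<cdot> z - y \<cdot> (x \<cdot> z)"
begin

definition sub_adjacent :: "'a \<Rightarrow> 'a \<Rightarrow> 'a" where
  "sub_adjacent x y = x \<cdot> y - y \<cdot> x"

definition coregular :: "'a \<Rightarrow> 'a dual \<Rightarrow> 'a dual" where
  "coregular x \<xi> = Dual (\<lambda>y. - ev \<xi> (x \<cdot> y))"

lemma linear_mul_right: "linear (\<lambda>y. x \<cdot> y)"
  using bilinear_mul by (simp add: bilinear_def)

lemma ev_coregular: "ev (coregular x \<xi>) y = - ev \<xi> (x \<cdot> y)"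
proof -
  have "linear (\<lambda>y. - ev \<xi> (x \<cdot> y))"
    using linear_compose_neg[OF linear_compose[OF linear_mul_right linear_ev]]
    by (simp add: o_def)
  then show ?thesis
    by (simp add: coregular_def ev_Dual)
qed

lemmas mul_simps =
  bilinear_ladd[OF bilinear_mul] bilinear_radd[OF bilinear_mul]
  bilinear_lsub[OF bilinear_mul] bilinear_rsub[OF bilinear_mul]
  bilinear_lmul[OF bilinear_mul] bilinear_rmul[OF bilinear_mul]

end

text \<open>The sub-adjacent Lie algebra and its coregular representation on the dual.\<close>

sublocale pre_lie_algebra \<subseteq> coreg: lie_algebra_representation sub_adjacent coregular
proof
  show "bilinear sub_adjacent"
    unfolding bilinear_def
    by (auto intro!: linearI simp: sub_adjacent_def mul_simps algebra_simps)
  show "sub_adjacent x x = 0" for x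
    by (simp add: sub_adjacent_def)
  show "sub_adjacent x (sub_adjacent y z) + sub_adjacent y (sub_adjacent z x)
      + sub_adjacent z (sub_adjacent x y) = 0" for x y z
  proof -
    have "(a \<cdot> b) \<cdot> c = a \<cdot> (b \<cdot> c) + (b \<cdot> a) \<cdot> c - b \<cdot> (a \<cdot> c)" for a b c
      using pre_lie[of a b c] by (simp add: algebra_simps)
    from this[of x y z] this[of y z x] this[of z x y] show ?thesis
      by (simp add: sub_adjacent_def mul_simps)
  qed
  show "bilinear coregular"
    unfolding bilinear_def
    by (auto intro!: linearI dual_eqI
        simp: ev_coregular ev_simps mul_simps linear_add[OF linear_ev] linear_cmul[OF linear_ev]
          algebra_simps)
  show "coregular (sub_adjacent x y) v
      = coregular x (coregular y v) - coregular y (coregular x v)" for x y v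
  proof (rule dual_eqI)
    fix z
    have "sub_adjacent x y \<cdot> z = x \<cdot> (y \<cdot> z) - y \<cdot> (x \<cdot> z)"
      using pre_lie[of x y z] by (simp add: sub_adjacent_def mul_simps algebra_simps)
    then show "ev (coregular (sub_adjacent x y) v) z
        = ev (coregular x (coregular y v) - coregular y (coregular x v)) z"
      by (simp add: ev_coregular ev_simps linear_diff[OF linear_ev])
  qed
qed

context pre_lie_algebra
begin

definition invariant :: "('a \<Rightarrow> 'a \<Rightarrow> real) \<Rightarrow> bool" where
  "invariant \<omega> \<longleftrightarrow> (\<forall>x y z. \<omega> (x \<cdot> y) z + \<omega> y (sub_adjacent x z) = 0)"

definition derivation :: "('a \<Rightarrow> 'a) \<Rightarrow> bool" where
  "derivation d \<longleftrightarrow> linear d \<and> (\<forall>x y. d (x \<cdot> y) = d x \<cdot> y + x \<cdot> d y)"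

definition hyper_differential_operator :: "(3 \<Rightarrow> real) \<Rightarrow> (3 \<Rightarrow> 'a \<Rightarrow> 'a) \<Rightarrow> bool" where
  "hyper_differential_operator \<epsilon> d \<longleftrightarrow>
     (\<forall>i. derivation (d i) \<and> bij (d i)) \<and>
     (\<forall>i. (inv (d (i - 1)) \<circ> d (i + 1)) ^^ 2 = (\<lambda>x. \<epsilon> i *\<^sub>R x))"

definition hessian_structure :: "('a \<Rightarrow> 'a \<Rightarrow> real) \<Rightarrow> bool" where
  "hessian_structure B \<longleftrightarrow>
     bilinear B \<and> (\<forall>x y. B x y = B y x) \<and> nondegenerate B \<and>
     (\<forall>x y z. B (x \<cdot> y) z - B x (y \<cdot> z) = B (y \<cdot> x) z - B y (x \<cdot> z))"

definition hyper_hessian_structure :: "(3 \<Rightarrow> real) \<Rightarrow> (3 \<Rightarrow> 'a \<Rightarrow> 'a \<Rightarrow> real) \<Rightarrow> bool" where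
  "hyper_hessian_structure \<epsilon> B \<longleftrightarrow>
     (\<forall>i. hessian_structure (B i)) \<and>
     coreg.hyper_relative_differential_operator \<epsilon> (\<lambda>i. natural (B i))"

end

end

theory Submission
  imports Defs
begin

text \<open>
  Everything rests on the map \<open>\<Omega> = natural \<omega>\<close> from the space to its dual, which is an
  isomorphism because \<open>\<omega>\<close> is nondegenerate and the space is finite-dimensional. The map induced
  by \<open>B\<^sub>i\<close> is \<open>\<Omega> \<circ> d\<^sub>i\<close>, so \<open>\<Omega>\<close> cancels from the composites
  \<open>inv (\<Omega> \<circ> d\<^sub>i\<^sub>-\<^sub>1) \<circ> (\<Omega> \<circ> d\<^sub>i\<^sub>+\<^sub>1)\<close>: the two conditions on squares are the same, and so are
  the two invertibility conditions.

  What remains is to compare, for a single symmetric endomorphism \<open>d\<close>, the derivation law with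
  the Hessian law. Invariance of \<open>\<omega>\<close> moves a left multiplication across \<open>\<omega>\<close> and turns it into a
  bracket. Applied to the Hessian law of \<open>\<omega> (d x) y\<close>, it shows that this law says exactly that
  \<open>d\<close> is a derivation of the sub-adjacent Lie algebra. Since a symmetric endomorphism is
  skew-adjoint, \<open>\<omega> (d x) y = - \<omega> x (d y)\<close>, the same move applied to the pre-Lie derivation law
  also gives the Lie derivation law. The Hessian law is, after pairing with an arbitrary
  vector, the defining law of a relative differential operator for the coregular representation.
\<close>

section \<open>The isomorphism with the dual\<close>

lemma linear_bilinear_right: "bilinear B \<Longrightarrow> linear (B x)"
  by (simp add: bilinear_def)

lemma ev_natural: "bilinear B \<Longrightarrow> ev (natural B x) y = B x y"
  by (simp add: natural_def ev_Dual linear_bilinear_right)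

lemma nondegenerate_eqI:
  assumes "bilinear \<omega>" "nondegenerate \<omega>" "\<And>z. \<omega> x z = \<omega> y z"
  shows "x = y"
proof -
  have "\<omega> (x - y) z = 0" for z
    using assms(3) by (simp add: bilinear_lsub[OF assms(1)])
  then show ?thesis
    using assms(2) unfolding nondegenerate_def by (metis eq_iff_diff_eq_0)
qed

text \<open>
  A functional is determined by its values on a basis, so it may be encoded as the vector having
  these values as coordinates. Under this encoding \<open>natural \<omega>\<close> becomes an endomorphism, for
  which injectivity implies surjectivity.
\<close>

lemma bij_natural:
  fixes \<omega> :: "'a::real_vector \<Rightarrow> 'a \<Rightarrow> real"
  assumes fin: "finite_dimensional_vector_space (scaleR :: real \<Rightarrow> 'a \<Rightarrow> 'a) E"
    and bil: "bilinear \<omega>"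
    and nondeg: "nondegenerate \<omega>"
  shows "bij (natural \<omega>)"
proof -
  interpret V: finite_dimensional_vector_space "scaleR :: real \<Rightarrow> 'a \<Rightarrow> 'a" E
    by (rule fin)
  have indep: "independent E" and span: "span E = UNIV"
    using V.independent_Basis V.span_Basis by (simp_all add: dependent_raw_def span_raw_def)
  note finB = V.finite_Basis
  have coord_unique: "f b = g b"
    if "(\<Sum>b\<in>E. f b *\<^sub>R b) = (\<Sum>b\<in>E. g b *\<^sub>R b)" "b \<in> E" for f g :: "'a \<Rightarrow> real" and b
  proof -
    have "(\<Sum>b\<in>E. (f b - g b) *\<^sub>R b) = 0"
      using that by (simp add: scaleR_diff_left sum_subtractf)
    from independentD[OF indep finB subset_refl this \<open>b \<in> E\<close>] show ?thesis by simp
  qed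
  have eq_on_Basis: "f = g" if "linear f" "linear g" "\<And>b. b \<in> E \<Longrightarrow> f b = g b"
    for f g :: "'a \<Rightarrow> real"
    using linear_eq_on_span[OF that] span by auto
  note inj = nondegenerate_eqI[OF bil nondeg]
  define A where "A x = (\<Sum>b\<in>E. \<omega> x b *\<^sub>R b)" for x
  have "linear A"
    by (rule linearI)
      (simp_all add: A_def bilinear_ladd[OF bil] bilinear_lmul[OF bil] scaleR_add_left
        sum.distrib scaleR_sum_right)
  moreover have "inj A"
  proof (rule injI)
    fix x y assume "A x = A y"
    then have "\<omega> x b = \<omega> y b" if "b \<in> E" for b
      using coord_unique[of "\<omega> x" "\<omega> y"] that by (simp add: A_def)
    then have "\<omega> x = \<omega> y"
      using eq_on_Basis linear_bilinear_right[OF bil] by blast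
    then show "x = y"
      using inj by metis
  qed
  ultimately have "surj A"
    using V.linear_inj_imp_surj by (simp add: linear_def)
  have "\<exists>x. natural \<omega> x = \<xi>" for \<xi>
  proof -
    obtain x where "A x = (\<Sum>b\<in>E. ev \<xi> b *\<^sub>R b)"
      using \<open>surj A\<close> by (metis surjD)
    then have "\<omega> x b = ev \<xi> b" if "b \<in> E" for b
      using coord_unique[of "\<omega> x" "ev \<xi>"] that by (simp add: A_def)
    then have "\<omega> x = ev \<xi>"
      using eq_on_Basis linear_bilinear_right[OF bil] linear_ev by blast
    then have "natural \<omega> x = \<xi>"
      by (simp add: dual_eqI ev_natural[OF bil])
    then show ?thesis ..
  qed
  moreover have "inj (natural \<omega>)"
    by (rule injI) (metis inj ev_natural[OF bil])
  ultimately show ?thesis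
    by (metis bijI surjI surj_def)
qed

section \<open>Composition with an isomorphism\<close>

lemma bij_comp_left_iff:
  assumes "bij h"
  shows "bij (h \<circ> f) \<longleftrightarrow> bij f"
proof
  assume "bij (h \<circ> f)"
  then have "bij (inv h \<circ> (h \<circ> f))"
    using bij_comp bij_imp_bij_inv[OF assms] by blast
  moreover have "inv h \<circ> (h \<circ> f) = f"
    using assms by (simp add: fun_eq_iff bij_is_inj)
  ultimately show "bij f" by simp
qed (use assms bij_comp in blast)

lemma inv_comp_cancel_left:
  assumes "bij h" "bij f"
  shows "inv (h \<circ> f) \<circ> (h \<circ> g) = inv f \<circ> g"
proof
  fix x
  have "inv h (h (g x)) = g x"
    using assms(1) by (simp add: bij_is_inj)
  then show "(inv (h \<circ> f) \<circ> (h \<circ> g)) x = (inv f \<circ> g) x"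
    by (simp add: o_inv_distrib[OF assms])
qed

section \<open>Derivations and Hessian structures\<close>

locale symplectic_pre_lie_algebra = pre_lie_algebra mul
  for mul :: "'a::real_vector \<Rightarrow> 'a \<Rightarrow> 'a"  (infixl \<open>\<cdot>\<close> 70) +
  fixes \<omega> :: "'a \<Rightarrow> 'a \<Rightarrow> real"
  assumes bilinear_omega: "bilinear \<omega>"
    and skew: "\<omega> x y = - \<omega> y x"
    and nondegenerate_omega: "nondegenerate \<omega>"
    and invariant_omega: "invariant \<omega>"
begin

lemmas omega_simps =
  bilinear_ladd[OF bilinear_omega] bilinear_radd[OF bilinear_omega]
  bilinear_lsub[OF bilinear_omega] bilinear_rsub[OF bilinear_omega]
  bilinear_lmul[OF bilinear_omega] bilinear_rmul[OF bilinear_omega]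

lemma omega_mul_left: "\<omega> (x \<cdot> y) z = - \<omega> y (sub_adjacent x z)"
  using invariant_omega unfolding invariant_def by (metis eq_neg_iff_add_eq_0)

lemma omega_mul_right: "\<omega> x (y \<cdot> z) = - \<omega> (sub_adjacent y x) z"
  using omega_mul_left[of y z x] skew by metis

definition lie_derivation :: "('a \<Rightarrow> 'a) \<Rightarrow> bool" where
  "lie_derivation d \<longleftrightarrow>
     (\<forall>x y. d (sub_adjacent x y) = sub_adjacent (d x) y + sub_adjacent x (d y))"

lemma symmetric_endomorphism_skew_adjoint:
  assumes "symmetric_endomorphism \<omega> d"
  shows "\<omega> (d x) y = - \<omega> x (d y)"
  using assms skew unfolding symmetric_endomorphism_def by metis

text \<open>
  A derivation of the product is one of the commutator. For the converse, both \<open>d\<close> and left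
  multiplication by \<open>x\<close> can be moved across \<open>\<omega>\<close>; the defect of the pre-Lie law at \<open>x, y\<close>
  paired with \<open>z\<close> is then \<open>y\<close> paired with the defect of the Lie law at \<open>x, z\<close>.
\<close>

lemma derivation_iff_lie_derivation:
  assumes sym: "symmetric_endomorphism \<omega> d"
  shows "derivation d \<longleftrightarrow> lie_derivation d"
proof
  assume der: "derivation d"
  then have "linear d" by (simp add: derivation_def)
  with der show "lie_derivation d"
    by (simp add: derivation_def lie_derivation_def sub_adjacent_def linear_diff algebra_simps)
next
  assume lie: "lie_derivation d"
  note adj = symmetric_endomorphism_skew_adjoint[OF sym]
  have "d (x \<cdot> y) = d x \<cdot> y + x \<cdot> d y" for x y
  proof (rule nondegenerate_eqI[OF bilinear_omega nondegenerate_omega])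
    fix z
    have "\<omega> (d (x \<cdot> y)) z = \<omega> y (sub_adjacent x (d z))"
      by (simp add: adj omega_mul_left)
    also have "\<dots> = \<omega> y (d (sub_adjacent x z)) - \<omega> y (sub_adjacent (d x) z)"
      using lie by (simp add: lie_derivation_def omega_simps)
    also have "\<dots> = \<omega> (d x \<cdot> y + x \<cdot> d y) z"
      by (simp add: omega_simps omega_mul_left adj)
    finally show "\<omega> (d (x \<cdot> y)) z = \<omega> (d x \<cdot> y + x \<cdot> d y) z" .
  qed
  then show "derivation d"
    using sym by (simp add: derivation_def symmetric_endomorphism_def)
qed

lemma lie_derivation_iff_hessian_identity:
  assumes lin: "linear d"
  shows "lie_derivation d \<longleftrightarrow>
    (\<forall>x y z. \<omega> (d (x \<cdot> y)) z - \<omega> (d x) (y \<cdot> z) = \<omega> (d (y \<cdot> x)) z - \<omega> (d y) (x \<cdot> z))"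
proof -
  have "(\<omega> (d (x \<cdot> y)) z - \<omega> (d x) (y \<cdot> z) = \<omega> (d (y \<cdot> x)) z - \<omega> (d y) (x \<cdot> z))
      \<longleftrightarrow> \<omega> (d (sub_adjacent x y)) z = \<omega> (sub_adjacent (d x) y + sub_adjacent x (d y)) z"
    for x y z
    by (auto simp: omega_mul_right sub_adjacent_def linear_diff[OF lin] omega_simps)
  then show ?thesis
    unfolding lie_derivation_def
    using nondegenerate_eqI[OF bilinear_omega nondegenerate_omega] by metis
qed

lemma bilinear_comp_omega:
  assumes "linear d"
  shows "bilinear (\<lambda>x. \<omega> (d x))"
  unfolding bilinear_def
  by (auto intro!: linearI simp: omega_simps linear_add[OF assms] linear_cmul[OF assms])

lemma natural_comp_omega: "natural (\<lambda>x. \<omega> (d x)) = natural \<omega> \<circ> d"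
  by (simp add: fun_eq_iff natural_def)

text \<open>Symmetry of the form is symmetry of \<open>d\<close>, and injectivity of \<open>d\<close> makes the form
  nondegenerate, so for an injective symmetric \<open>d\<close> only the Hessian law is a condition.\<close>

lemma derivation_iff_hessian_structure:
  assumes sym: "symmetric_endomorphism \<omega> d" and inj: "inj d"
  shows "derivation d \<longleftrightarrow> hessian_structure (\<lambda>x. \<omega> (d x))"
proof -
  have lin: "linear d" and symB: "\<omega> (d x) y = \<omega> (d y) x" for x y
    using sym unfolding symmetric_endomorphism_def by blast+
  have "x = 0" if "\<forall>y. \<omega> (d x) y = 0" for x
  proof -
    have "d x = 0"
      using that nondegenerate_omega unfolding nondegenerate_def by blast
    then show "x = 0"
      using inj lin by (metis injD linear_0)
  qed
  then have "nondegenerate (\<lambda>x. \<omega> (d x))"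
    unfolding nondegenerate_def using symB by metis
  then show ?thesis
    unfolding derivation_iff_lie_derivation[OF sym] lie_derivation_iff_hessian_identity[OF lin]
      hessian_structure_def
    using bilinear_comp_omega[OF lin] symB by blast
qed

end

text \<open>After evaluation at a vector, the law of a relative differential operator is the Hessian law
  with its terms rearranged.\<close>

lemma (in pre_lie_algebra) hessian_structure_imp_relative_differential_operator:
  assumes "hessian_structure B"
  shows "coreg.relative_differential_operator (natural B)"
proof -
  have bil: "bilinear B"
    and hess: "B (x \<cdot> y) z - B x (y \<cdot> z) = B (y \<cdot> x) z - B y (x \<cdot> z)" for x y z
    using assms unfolding hessian_structure_def by blast+
  have "linear (natural B)"
    by (auto intro!: linearI dual_eqI
        simp: ev_natural[OF bil] ev_simps bilinear_ladd[OF bil] bilinear_lmul[OF bil])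
  moreover have "natural B (sub_adjacent x y)
      = coregular x (natural B y) - coregular y (natural B x)" for x y
  proof (rule dual_eqI)
    fix z
    show "ev (natural B (sub_adjacent x y)) z
        = ev (coregular x (natural B y) - coregular y (natural B x)) z"
      using hess[of x y z]
      by (simp add: ev_natural[OF bil] ev_simps ev_coregular sub_adjacent_def bilinear_lsub[OF bil])
  qed
  ultimately show ?thesis
    by (simp add: coreg.relative_differential_operator_def)
qed

section \<open>Hyper differential operators and hyper Hessian structures\<close>

theorem theorem5p15:
  fixes mul :: "'a::real_vector \<Rightarrow> 'a \<Rightarrow> 'a"
    and \<omega> :: "'a \<Rightarrow> 'a \<Rightarrow> real"
    and d :: "3 \<Rightarrow> 'a \<Rightarrow> 'a"
    and B :: "3 \<Rightarrow> 'a \<Rightarrow> 'a \<Rightarrow> real"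
    and \<epsilon> :: "3 \<Rightarrow> real"
  assumes "\<exists>Basis. finite_dimensional_vector_space (scaleR :: real \<Rightarrow> 'a \<Rightarrow> 'a) Basis"
    and "pre_lie_algebra mul"
    and "bilinear \<omega>"
    and "\<forall>x y. \<omega> x y = - \<omega> y x"
    and "nondegenerate \<omega>"
    and "pre_lie_algebra.invariant mul \<omega>"
    and "\<forall>i. symmetric_endomorphism \<omega> (d i)"
    and "\<forall>i x y. B i x y = \<omega> (d i x) y"
    and "\<forall>i. \<epsilon> i \<in> {1, -1}"
  shows "pre_lie_algebra.hyper_differential_operator mul \<epsilon> d
     \<longleftrightarrow> pre_lie_algebra.hyper_hessian_structure mul \<epsilon> B"
proof -
  interpret symplectic_pre_lie_algebra mul \<omega>
    using assms(2-6)
    unfolding symplectic_pre_lie_algebra_def symplectic_pre_lie_algebra_axioms_def by blast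
  have bij_omega: "bij (natural \<omega>)"
    using assms(1,3,5) bij_natural by blast
  have B: "B i = (\<lambda>x. \<omega> (d i x))" for i
    using assms(8) by (simp add: fun_eq_iff)
  have nat: "natural (B i) = natural \<omega> \<circ> d i" for i
    unfolding B by (rule natural_comp_omega)
  have bij_iff: "bij (natural (B i)) \<longleftrightarrow> bij (d i)" for i
    by (simp add: nat bij_comp_left_iff[OF bij_omega])
  have composite: "inv (natural (B i)) \<circ> natural (B j) = inv (d i) \<circ> d j" if "bij (d i)" for i j
    by (simp only: nat inv_comp_cancel_left[OF bij_omega that])
  have hessian: "hessian_structure (B i) \<longleftrightarrow> derivation (d i)" if "bij (d i)" for i
    unfolding B using derivation_iff_hessian_structure[OF _ bij_is_inj[OF that]] assms(7) by blast
  show ?thesis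
  proof (cases "\<forall>i. bij (d i)")
    case True
    then have bij: "bij (d i)" for i by blast
    have "(\<forall>i. hessian_structure (B i) \<and> coreg.relative_differential_operator (natural (B i)))
        \<longleftrightarrow> (\<forall>i. derivation (d i))"
      using hessian[OF bij] hessian_structure_imp_relative_differential_operator by blast
    then show ?thesis
      unfolding hyper_differential_operator_def hyper_hessian_structure_def
        coreg.hyper_relative_differential_operator_def composite[OF bij] bij_iff
      by (simp add: bij) blast
  next
    case False
    then show ?thesis
      unfolding hyper_differential_operator_def hyper_hessian_structure_def
        coreg.hyper_relative_differential_operator_def
      using bij_iff by blast
  qed
qed

end
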